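(* Let $k \geq 1$ be an integer and let $G$ be a connected graph. If $\chi_c(G) = \frac{2k+1}{k}$, then $G$ folds to $C_{2k+1}$. Furthermore, any graph which folds to $C_{2k+1}$ is $C_{2k+1}$-colourable.
   Context: Graphs are finite and simple; $C_n$ is the cycle on $n$ vertices. An $H$-colouring of $G$ is a homomorphism $G \to H$; $G$ is $H$-colourable if one exists. For positive integers $p,q$ with $p/q \ge 2$, a $(p,q)$-colouring of $G$ is a map $f: V(G) \to \{0,\dots,p-1\}$ with $q \le |f(u)-f(v)| \le p-q$ for every edge $uv$. The circular chromatic number $\chi_c(G)$ is the minimum of $p/q$ over all such $p,q$ for which $G$ has a $(p,q)$-colouring. For vertices $x,y$ of $G$ at distance exactly $2$, let $G_{xy}$ be the (simple) graph obtained by identifying $x$ and $y$ into a new vertex $v_{xy}$; the homomorphism $G\to G_{xy}$ sending $x,y\mapsto v_{xy}$ and fixing all other vertices is an elementary fold. $G$ folds to $H$ if there is a homomorphism $f: G\to H$ which is a composition of (zero or more) elementary folds with $f(G)$ isomorphic to $H$. *)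

theory Defs
  imports Complex_Main "Graph_Theory.Graph_Theory"
begin

text \<open>
  A finite simple graph is a \<^typ>\<open>'a pair_pre_digraph\<close> satisfying the library locale
  predicate \<^const>\<open>pair_graph\<close>: finite, loop-free and symmetric, so that each
  undirected edge is represented by both of its orientations.
\<close>

definition cycle_graph :: "nat \<Rightarrow> nat pair_pre_digraph" where
  "cycle_graph n = \<lparr> pverts = {0..<n},
     parcs = {(i, j). i < n \<and> j < n \<and> (j = Suc i mod n \<or> i = Suc j mod n)} \<rparr>"

lemma pair_graph_cycle_graph:
  assumes "3 \<le> n" shows "pair_graph (cycle_graph n)"
proof -
  have "parcs (cycle_graph n) \<subseteq> {0..<n} \<times> {0..<n}"
    by (auto simp: cycle_graph_def)
  then have fin: "finite (parcs (cycle_graph n))"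
    by (rule finite_subset) simp
  have neq: "Suc i mod n \<noteq> i" if "i < n" for i
    using assms that by (cases "Suc i = n") auto
  have loopfree: "fst e \<noteq> snd e" if "e \<in> parcs (cycle_graph n)" for e
    using that neq[of "fst e"] neq[of "snd e"] by (auto simp: cycle_graph_def)
  have symm: "sym (parcs (cycle_graph n))"
    unfolding sym_def cycle_graph_def by simp blast
  show ?thesis
  proof
    fix e assume "e \<in> parcs (cycle_graph n)"
    then show "fst e \<in> pverts (cycle_graph n)" "snd e \<in> pverts (cycle_graph n)" "fst e \<noteq> snd e"
      by (auto simp: loopfree) (auto simp: cycle_graph_def)
  qed (use fin symm in \<open>simp_all add: symmetric_def, simp add: cycle_graph_def\<close>)
qed

definition graph_hom :: "'a pair_pre_digraph \<Rightarrow> 'b pair_pre_digraph \<Rightarrow> ('a \<Rightarrow> 'b) \<Rightarrow> bool" where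
  "graph_hom G H f \<longleftrightarrow> f ` pverts G \<subseteq> pverts H \<and> (\<forall>(u, v) \<in> parcs G. (f u, f v) \<in> parcs H)"

definition colourable :: "'a pair_pre_digraph \<Rightarrow> 'b pair_pre_digraph \<Rightarrow> bool" where
  "colourable H G \<longleftrightarrow> (\<exists>f. graph_hom G H f)"

definition pq_colouring :: "nat \<Rightarrow> nat \<Rightarrow> 'a pair_pre_digraph \<Rightarrow> ('a \<Rightarrow> nat) \<Rightarrow> bool" where
  "pq_colouring p q G f \<longleftrightarrow> f ` pverts G \<subseteq> {0..<p} \<and>
     (\<forall>(u, v) \<in> parcs G. int q \<le> \<bar>int (f u) - int (f v)\<bar> \<and>
                          \<bar>int (f u) - int (f v)\<bar> \<le> int p - int q)"

text \<open>The minimum is attained for every finite simple graph, so \<open>LEAST\<close> is meaningful there.\<close>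

definition circular_chromatic_number :: "'a pair_pre_digraph \<Rightarrow> real" where
  "circular_chromatic_number G =
     (LEAST r. \<exists>p q. 0 < p \<and> 0 < q \<and> 2 \<le> real p / real q \<and>
                     (\<exists>f. pq_colouring p q G f) \<and> r = real p / real q)"

definition graph_image :: "('a \<Rightarrow> 'b) \<Rightarrow> 'a pair_pre_digraph \<Rightarrow> 'b pair_pre_digraph" where
  "graph_image f G = \<lparr> pverts = f ` pverts G, parcs = map_prod f f ` parcs G \<rparr>"

definition graph_distance :: "'a pair_pre_digraph \<Rightarrow> 'a \<Rightarrow> 'a \<Rightarrow> ereal" where
  "graph_distance G = wf_digraph.\<mu> (with_proj G) (\<lambda>_. 1)"

definition identify :: "'a \<Rightarrow> 'a \<Rightarrow> 'a \<Rightarrow> 'a \<Rightarrow> 'a" where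
  "identify x y v w = (if w = x \<or> w = y then v else w)"

text \<open>
  The name \<open>v\<close> of the vertex replacing \<open>x\<close> and \<open>y\<close> is any element distinct from the
  remaining vertices. It may be \<open>x\<close> or \<open>y\<close> itself: the vertex type may have no
  further elements, and graphs matter only up to isomorphism. The resulting
  \<open>G\<^sub>x\<^sub>y\<close> is the image of \<open>G\<close>, in which parallel edges coincide.
\<close>

definition elementary_fold ::
    "'a pair_pre_digraph \<Rightarrow> ('a \<Rightarrow> 'a) \<Rightarrow> 'a pair_pre_digraph \<Rightarrow> bool" where
  "elementary_fold G f G' \<longleftrightarrow>
     (\<exists>x y v. x \<in> pverts G \<and> y \<in> pverts G \<and> graph_distance G x y = 2 \<and>
              v \<notin> pverts G - {x, y} \<and>
              f = identify x y v \<and> G' = graph_image f G)"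

inductive fold_composition ::
    "'a pair_pre_digraph \<Rightarrow> ('a \<Rightarrow> 'a) \<Rightarrow> 'a pair_pre_digraph \<Rightarrow> bool" for G where
  refl: "fold_composition G id G"
| step: "fold_composition G f G' \<Longrightarrow> elementary_fold G' g G'' \<Longrightarrow> fold_composition G (g \<circ> f) G''"

definition folds_to :: "'a pair_pre_digraph \<Rightarrow> 'b pair_pre_digraph \<Rightarrow> bool" where
  "folds_to G H \<longleftrightarrow>
     (\<exists>f G'. fold_composition G f G' \<and>
             digraph_iso (with_proj (graph_image f G)) (with_proj H))"

lemma graph_hom_graph_image: "graph_hom G (graph_image f G) f"
  by (force simp: graph_hom_def graph_image_def)

lemma fold_composition_image: "fold_composition G f G' \<Longrightarrow> graph_image f G = G'"
proof (induction rule: fold_composition.induct)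
  case refl
  then show ?case by (simp add: graph_image_def map_prod.id)
next
  case (step f G' g G'')
  then have "G'' = graph_image g (graph_image f G)"
    by (auto simp: elementary_fold_def)
  then show ?case
    by (simp only: graph_image_def image_comp map_prod.comp pair_pre_digraph.simps)
qed

lemma graph_distance_eq_2_iff:
  assumes "pair_graph G"
  shows "graph_distance G x y = 2 \<longleftrightarrow>
           x \<noteq> y \<and> (x, y) \<notin> parcs G \<and> (\<exists>z. (x, z) \<in> parcs G \<and> (z, y) \<in> parcs G)"
proof -
  interpret pair_graph G by fact
  have cost: "awalk_cost (\<lambda>_. 1) p = real (length p)" for p :: "('a \<times> 'a) list"
    by (induction p) auto
  have dist: "graph_distance G x y = (INF p\<in>{p. awalk x p y}. ereal (real (length p)))"
    by (simp add: graph_distance_def \<mu>_def cost)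
  have e2: "(2 :: ereal) = ereal 2" by simp
  have nil: "awalk x [] y \<longleftrightarrow> x \<in> pverts G \<and> x = y"
    by (auto simp: awalk_def)
  have one: "awalk x [e] y \<longleftrightarrow> e = (x, y) \<and> (x, y) \<in> parcs G" for e
    by (cases e) (auto simp: awalk_def dest: wellformed')
  have two: "awalk x [e, e'] y \<longleftrightarrow>
      (\<exists>z. e = (x, z) \<and> e' = (z, y) \<and> (x, z) \<in> parcs G \<and> (z, y) \<in> parcs G)" for e e'
    by (cases e; cases e') (auto simp: awalk_def dest: wellformed')
  show ?thesis
  proof
    assume d: "graph_distance G x y = 2"
    have ge: "2 \<le> length p" if "awalk x p y" for p
    proof -
      have "graph_distance G x y \<le> ereal (real (length p))"
        unfolding dist using that by (intro INF_lower) auto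
      then show ?thesis unfolding d e2 ereal_less_eq(3) by simp
    qed
    have "\<exists>p. awalk x p y \<and> length p < 3"
    proof (rule ccontr)
      assume "\<not> ?thesis"
      then have "ereal 3 \<le> graph_distance G x y"
        unfolding dist by (intro INF_greatest) (force simp: not_less)
      then show False unfolding d e2 ereal_less_eq(3) by simp
    qed
    then obtain p where p: "awalk x p y" "length p = 2"
      using ge by (force simp: numeral_3_eq_3 less_Suc_eq_le numeral_2_eq_2 intro: le_antisym)
    then obtain e e' where "p = [e, e']"
      by (auto simp: numeral_2_eq_2 length_Suc_conv)
    then have z: "\<exists>z. (x, z) \<in> parcs G \<and> (z, y) \<in> parcs G"
      using p two by auto
    have "x \<noteq> y" using ge[of "[]"] nil z by (auto dest: wellformed')
    moreover have "(x, y) \<notin> parcs G" using ge[of "[(x, y)]"] one by auto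
    ultimately show "x \<noteq> y \<and> (x, y) \<notin> parcs G \<and> (\<exists>z. (x, z) \<in> parcs G \<and> (z, y) \<in> parcs G)"
      using z by blast
  next
    assume r: "x \<noteq> y \<and> (x, y) \<notin> parcs G \<and> (\<exists>z. (x, z) \<in> parcs G \<and> (z, y) \<in> parcs G)"
    then obtain z where "(x, z) \<in> parcs G" "(z, y) \<in> parcs G" by blast
    then have w: "awalk x [(x, z), (z, y)] y" using two by blast
    have ge: "2 \<le> length p" if "awalk x p y" for p
    proof (rule ccontr)
      assume "\<not> 2 \<le> length p"
      then have "p = [] \<or> (\<exists>e. p = [e])" by (cases p; cases "tl p") auto
      then show False using that nil one r by auto
    qed
    have "graph_distance G x y \<le> ereal (real (length [(x, z), (z, y)]))"
      unfolding dist using w by (intro INF_lower) auto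
    moreover have "ereal 2 \<le> graph_distance G x y"
      unfolding dist by (intro INF_greatest) (use ge in force)
    ultimately show "graph_distance G x y = 2" unfolding e2 by (intro antisym) simp_all
  qed
qed

lemma elementary_fold_pair_graph:
  assumes "pair_graph G" "elementary_fold G f G'"
  shows "pair_graph G'"
proof -
  interpret pair_graph G by fact
  obtain x y v where f: "f = identify x y v" and G': "G' = graph_image f G"
    and v: "v \<notin> pverts G - {x, y}" and nadj: "(x, y) \<notin> parcs G" "(y, x) \<notin> parcs G"
    using assms graph_distance_eq_2_iff[OF assms(1)]
    by (auto simp: elementary_fold_def dest: arcs_symmetric)
  have "f a \<noteq> f b" if "(a, b) \<in> parcs G" for a b
    using that v nadj no_loops'[OF that] by (auto simp: f identify_def dest: wellformed')
  then show ?thesis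
    using pair_finite_verts pair_finite_arcs
    by unfold_locales
      (auto simp: G' graph_image_def symmetric_def sym_def dest: wellformed' arcs_symmetric)
qed

end

(*
  A fold identifying two vertices at distance 2 that get the same colour under a
  homomorphism f to C_{2k+1} leaves f well defined on the quotient. Folding in this way
  until the number of vertices is minimal makes f locally injective, so that "the colour
  increases by 1" is an injective partial function on the vertices. If it has no cycle,
  the quotient is bipartite; otherwise, by connectedness, the quotient is a cycle C_m
  with 2k+1 dividing m. Since the circular chromatic number does not drop along
  homomorphisms, bipartiteness (value 2) and m > 2k+1 (value 2 + 2/(m-1) for odd m) are
  excluded, and f is an isomorphism.

  To get f in the first place, the minimum defining the circular chromatic number has to be
  attained: in lowest terms, a (p,q)-colouring with more colours than vertices misses a
  colour and can be compressed to a (p',q')-colouring, where p'/q' < p/q is the lower Farey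
  neighbour.
*)

theory Submission
  imports Defs
begin

section \<open>Circular colourings as colourings by residues\<close>

text \<open>
  Colours are taken modulo \<open>p\<close>, so that translations and multiplications of colourings need
  no normalisation to the range \<open>{0..<p}\<close>.
\<close>

definition mod_colouring :: "int \<Rightarrow> int \<Rightarrow> 'a pair_pre_digraph \<Rightarrow> ('a \<Rightarrow> int) \<Rightarrow> bool" where
  "mod_colouring p q G F \<longleftrightarrow> (\<forall>(u, v) \<in> parcs G. (F u - F v) mod p \<in> {q..p - q})"

definition circ_colourable :: "nat \<Rightarrow> nat \<Rightarrow> 'a pair_pre_digraph \<Rightarrow> bool" where
  "circ_colourable p q G \<longleftrightarrow> 0 < q \<and> 2 * q \<le> p \<and> (\<exists>F. mod_colouring (int p) (int q) G F)"

lemma int_less_mult_imp_div_less: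
  fixes x d p :: int
  assumes "0 < d" "x < d * p"
  shows "x div d < p"
proof -
  have "d * (x div d) \<le> x" using mult_div_mod_eq[of d x] pos_mod_sign[OF assms(1), of x] by linarith
  then have "d * (x div d) < d * p" using assms by linarith
  then show ?thesis using assms by simp
qed

text \<open>For reduced colours, \<open>(a - b) mod p\<close> is \<open>\<bar>a - b\<bar>\<close> or
  \<open>p - \<bar>a - b\<bar>\<close>, and the interval from \<open>q\<close> to
  \<open>p - q\<close> is symmetric under \<open>x \<mapsto> p - x\<close>.\<close>

lemma circular_distance_iff_mod:
  fixes p q a b :: int
  assumes "0 < q" "0 \<le> a" "a < p" "0 \<le> b" "b < p"
  shows "q \<le> \<bar>a - b\<bar> \<and> \<bar>a - b\<bar> \<le> p - q \<longleftrightarrow> (a - b) mod p \<in> {q..p - q}"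
proof (cases "b \<le> a")
  case True
  then have "(a - b) mod p = a - b" using assms by simp
  then show ?thesis using True by auto
next
  case False
  have "(a - b) mod p = (a - b + p) mod p" by simp
  also have "\<dots> = a - b + p" using assms False by (intro mod_pos_pos_trivial) auto
  finally show ?thesis using False by auto
qed

lemma mod_colouring_iff_reduced:
  assumes "0 < p" "0 < q"
  shows "mod_colouring p q G F \<longleftrightarrow>
    (\<forall>(u, v) \<in> parcs G. q \<le> \<bar>F u mod p - F v mod p\<bar> \<and> \<bar>F u mod p - F v mod p\<bar> \<le> p - q)"
proof -
  have "q \<le> \<bar>F u mod p - F v mod p\<bar> \<and> \<bar>F u mod p - F v mod p\<bar> \<le> p - q \<longleftrightarrow>
      (F u - F v) mod p \<in> {q..p - q}" for u v
    using circular_distance_iff_mod[of q "F u mod p" p "F v mod p"] assms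
    by (simp add: mod_diff_eq)
  then show ?thesis by (simp add: mod_colouring_def)
qed

text \<open>The bridge to the given definition: a natural-number colouring is read in the integers,
  and an integer one is reduced modulo \<open>p\<close>.\<close>

lemma pq_colouring_iff_circ_colourable:
  assumes "pair_graph G"
  shows "0 < p \<and> 0 < q \<and> 2 \<le> real p / real q \<and> (\<exists>f. pq_colouring p q G f) \<longleftrightarrow>
    circ_colourable p q G"
proof -
  interpret pair_graph G by fact
  have ratio: "2 \<le> real p / real q \<longleftrightarrow> 2 * q \<le> p" if "0 < q"
  proof -
    have "2 \<le> real p / real q \<longleftrightarrow> real (2 * q) \<le> real p"
      using that by (simp add: pos_le_divide_eq)
    then show ?thesis by (simp only: of_nat_le_iff)
  qed
  have "(\<exists>f. pq_colouring p q G f) \<longleftrightarrow> (\<exists>F. mod_colouring (int p) (int q) G F)"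
    if pos: "0 < p" "0 < q"
  proof
    assume "\<exists>f. pq_colouring p q G f"
    then obtain f where f: "pq_colouring p q G f" ..
    have "int (f u) mod int p = int (f u)" if "u \<in> pverts G" for u
      using f that by (auto simp: pq_colouring_def)
    then have "mod_colouring p q G (\<lambda>u. int (f u))"
      using f pos wellformed'
      by (fastforce simp: mod_colouring_iff_reduced pq_colouring_def)
    then show "\<exists>F. mod_colouring (int p) (int q) G F" by blast
  next
    assume "\<exists>F. mod_colouring (int p) (int q) G F"
    then obtain F where "mod_colouring (int p) (int q) G F" ..
    then have "pq_colouring p q G (\<lambda>u. nat (F u mod int p))"
      using pos by (auto simp: mod_colouring_iff_reduced pq_colouring_def nat_less_iff)
    then show "\<exists>f. pq_colouring p q G f" by blast
  qed
  then show ?thesis using ratio by (auto simp: circ_colourable_def)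
qed

lemma circular_chromatic_number_conv:
  assumes "pair_graph G"
  shows "circular_chromatic_number G =
    (LEAST r. \<exists>p q. circ_colourable p q G \<and> r = real p / real q)"
  unfolding circular_chromatic_number_def pq_colouring_iff_circ_colourable[OF assms, symmetric]
  by (simp add: conj_ac)

section \<open>Rounding, Farey neighbours and attainment of the minimum\<close>

text \<open>Reduced colours are divided by \<open>d\<close> and rounded down. Floor division is
  monotone and commutes with adding multiples of \<open>d\<close>, so both bounds on differences
  survive division by \<open>d\<close>.\<close>

lemma circ_colourable_scale:
  assumes "circ_colourable (d * p) (d * q) G" "0 < d"
  shows "circ_colourable p q G"
proof -
  have q: "0 < q" and pq: "2 * q \<le> p" using assms by (auto simp: circ_colourable_def)
  obtain F where F: "mod_colouring (int d * int p) (int d * int q) G F"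
    using assms by (auto simp: circ_colourable_def)
  define h where "h u = (F u mod (int d * int p)) div int d" for u
  have h_range: "0 \<le> h u \<and> h u < int p" for u
  proof -
    have "F u mod (int d * int p) < int d * int p" using assms q pq by simp
    then have "h u < int p"
      unfolding h_def using assms(2) by (intro int_less_mult_imp_div_less) simp_all
    moreover have "0 \<le> h u" using assms q pq by (simp add: h_def pos_imp_zdiv_nonneg_iff)
    ultimately show ?thesis by simp
  qed
  \<comment> \<open>Serves both bounds: the lower one with \<open>m = q\<close>, the upper one with
    the nonpositive \<open>m = q - p\<close>.\<close>
  have mono: "a div int d + m \<le> b div int d" if "a + int d * m \<le> b" for a b m :: int
    using zdiv_mono1[OF that, of "int d"] assms(2) by simp
  have dp: "0 < int d * int p" "0 < int d * int q" using assms q pq by auto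
  have "mod_colouring p q G h"
    unfolding mod_colouring_def
  proof (intro ballI, clarify)
    fix u v assume "(u, v) \<in> parcs G"
    define a b where ab: "a = F u mod (int d * int p)" "b = F v mod (int d * int p)"
    have *: "int d * int q \<le> \<bar>a - b\<bar>" "\<bar>a - b\<bar> \<le> int d * int p - int d * int q"
      using F \<open>(u, v) \<in> parcs G\<close> dp by (auto simp: mod_colouring_iff_reduced ab)
    have e: "h u = a div int d" "h v = b div int d" by (simp_all add: h_def ab)
    have "int q \<le> \<bar>h u - h v\<bar> \<and> \<bar>h u - h v\<bar> \<le> int p - int q"
    proof (cases "b \<le> a")
      case True
      then have "b + int d * int q \<le> a" "a + int d * (int q - int p) \<le> b"
        using * by (simp_all add: algebra_simps)
      from this[THEN mono] show ?thesis unfolding e by linarith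
    next
      case False
      then have "a + int d * int q \<le> b" "b + int d * (int q - int p) \<le> a"
        using * by (simp_all add: algebra_simps)
      from this[THEN mono] show ?thesis unfolding e by linarith
    qed
    then show "(h u - h v) mod int p \<in> {int q..int p - int q}"
      using circular_distance_iff_mod[of "int q" "h u" "int p" "h v"] h_range q by simp
  qed
  then show ?thesis using q pq by (auto simp: circ_colourable_def)
qed

text \<open>Bezout gives \<open>q'\<close>, which is reduced to \<open>q' \<le> q\<close> to force
  \<open>p' < p\<close>. Coprimality and \<open>3 \<le> p\<close> exclude \<open>p = 2 * q\<close>,
  and \<open>2 * q + 1 \<le> p\<close> is what keeps the smaller fraction \<open>p' / q'\<close> at
  2 or above.\<close>

lemma lower_Farey_neighbour:
  fixes p q :: nat
  assumes "coprime p q" "0 < q" "2 * q \<le> p" "3 \<le> p"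
  obtains p' q' where "p * q' = q * p' + 1" "0 < q'" "2 * q' \<le> p'" "p' < p"
proof -
  have ne: "p \<noteq> 2 * q"
  proof
    assume "p = 2 * q"
    then have "q dvd p" by simp
    then have "q = 1" using assms(1) by (metis coprime_common_divisor_nat dvd_refl)
    then show False using \<open>p = 2 * q\<close> assms by simp
  qed
  obtain q' p' where e: "p * q' = q * p' + 1" and q': "0 < q'" "q' \<le> q"
  \<comment> \<open>Separate because reduction modulo 1 would give \<open>q' = 0\<close>, which is
    not allowed.\<close>
  proof (cases "q = 1")
    case True
    then show ?thesis using that[of 1 "p - 1"] assms by simp
  next
    case False
    have "gcd p q = 1" "p \<noteq> 0" using assms by (simp_all add: coprime_iff_gcd_eq_1)
    then obtain x z where x: "p * x = q * z + 1"
      using bezout_nat[of p q] by auto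
    define y where "y = x mod q"
    have "(q * z + 1) mod q = 1" using False assms by (simp only: mod_mult_self4) simp
    then have y: "(p * y) mod q = 1" by (simp add: y_def mod_mult_right_eq x)
    have "y \<noteq> 0" using y by (cases y) auto
    moreover have "y \<le> q" using assms by (simp add: y_def)
    moreover have "p * y = q * ((p * y) div q) + 1"
      using y mult_div_mod_eq[of q "p * y"] by simp
    ultimately show ?thesis using that by blast
  qed
  have "(2 * q + 1) * q' \<le> p * q'" using assms ne by (intro mult_right_mono) auto
  then have "q * (2 * q') + q' \<le> p * q'" by (simp add: algebra_simps)
  then have "q * (2 * q') \<le> q * p'" using e q' by linarith
  then have "2 * q' \<le> p'" using assms by simp
  moreover have "p * q' \<le> q * p" using q' by (simp add: mult.commute)
  then have "q * p' < q * p" using e by linarith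
  then have "p' < p" by (simp only: mult_less_cancel1)
  ultimately show ?thesis using that e q' by blast
qed

text \<open>Colours strictly between 0 and \<open>p\<close> are compressed by
  \<open>i \<mapsto> \<lfloor>i * p' / p\<rfloor>\<close>. By coprimality both remainders lie
  between 1 and \<open>p - 1\<close>, so they differ by at most \<open>p - 2\<close>; together with
  the 1 in the Farey identity this stays below \<open>p\<close>, and no unit is lost in either
  bound.\<close>

lemma floor_scaled_difference:
  fixes p q p' q' i j :: int
  assumes "p * q' = q * p' + 1" "0 < p" "0 < p'" "0 < i" "i < p" "0 < j" "j < p" "coprime p p'"
    and "q \<le> j - i" "j - i \<le> p - q"
  shows "q' \<le> (j * p') div p - (i * p') div p" "(j * p') div p - (i * p') div p \<le> p' - q'"
proof -
  have pos: "0 < (x * p') mod p" if "0 < x" "x < p" for x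
  proof -
    have "\<not> p dvd x * p'"
      using that assms(8) zdvd_not_zless by (auto simp: coprime_dvd_mult_left_iff)
    then show ?thesis using \<open>0 < p\<close> by (simp add: dvd_eq_mod_eq_0 order_less_le)
  qed
  define a b r s where defs: "a = (i * p') div p" "b = (j * p') div p"
    "r = (i * p') mod p" "s = (j * p') mod p"
  have ij: "i * p' = p * a + r" "j * p' = p * b + s" by (simp_all add: defs)
  have rs: "0 < r" "r < p" "0 < s" "s < p" using pos assms by (auto simp: defs)
  have e: "p * (b - a) = (j - i) * p' - s + r" using ij by (simp add: algebra_simps)
  have "q * p' \<le> (j - i) * p'" using assms by (intro mult_right_mono) auto
  then have "p * (b - a) > p * (q' - 1)" using e rs assms(1) by (simp add: algebra_simps)
  then show "q' \<le> (j * p') div p - (i * p') div p"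
    using \<open>0 < p\<close> unfolding defs by (simp add: mult_less_cancel_left_pos)
  have "(j - i) * p' \<le> (p - q) * p'" using assms by (intro mult_right_mono) auto
  then have "p * (b - a) < p * (p' - q' + 1)" using e rs assms(1) by (simp add: algebra_simps)
  then show "(j * p') div p - (i * p') div p \<le> p' - q'"
    using \<open>0 < p\<close> unfolding defs by (simp add: mult_less_cancel_left_pos)
qed

lemma circ_colourable_descent:
  assumes G: "pair_graph G" and col: "circ_colourable p q G" and cop: "coprime p q"
    and "card (pverts G) < p" "3 \<le> p"
  obtains p' q' where "circ_colourable p' q' G" "p' < p" "p' * q \<le> p * q'"
proof -
  interpret pair_graph G by fact
  have q: "0 < q" "2 * q \<le> p" using col by (auto simp: circ_colourable_def)
  obtain F where F: "mod_colouring (int p) (int q) G F"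
    using col by (auto simp: circ_colourable_def)
  obtain p' q' where pq': "p * q' = q * p' + 1" "0 < q'" "2 * q' \<le> p'" "p' < p"
    using lower_Farey_neighbour[OF cop q \<open>3 \<le> p\<close>] by blast
  have "coprime p p'"
  proof (rule coprimeI)
    fix c assume "c dvd p" "c dvd p'"
    then have "c dvd p * q'" "c dvd q * p'" by auto
    then show "is_unit c" using pq'(1) by (metis dvd_add_right_iff)
  qed
  then have cop': "coprime (int p) (int p')" by simp
  have "card ((\<lambda>u. F u mod int p) ` pverts G) < card {0..<int p}"
    using card_image_le[OF pair_finite_verts, of "\<lambda>u. F u mod int p"] assms(4) by simp
  moreover have "(\<lambda>u. F u mod int p) ` pverts G \<subseteq> {0..<int p}" using \<open>3 \<le> p\<close> by auto
  ultimately obtain x where x: "0 \<le> x" "x < int p" "x \<notin> (\<lambda>u. F u mod int p) ` pverts G"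
    by (metis atLeastLessThan_iff less_irrefl subsetI subset_antisym)
  define h where "h u = (F u - x) mod int p" for u
  have h: "0 < h u" "h u < int p" if "u \<in> pverts G" for u
  proof -
    have "h u \<noteq> 0"
    proof
      assume "h u = 0"
      then have "F u mod int p = x mod int p" by (simp add: h_def mod_eq_dvd_iff dvd_eq_mod_eq_0)
      then show False using x that by auto
    qed
    moreover have "0 \<le> h u" using \<open>3 \<le> p\<close> by (simp add: h_def)
    ultimately show "0 < h u" by simp
    show "h u < int p" using \<open>3 \<le> p\<close> by (simp add: h_def)
  qed
  have pq'_int: "int p * int q' = int q * int p' + 1"
    using pq'(1) by (metis of_nat_1 of_nat_add of_nat_mult)
  \<comment> \<open>Rotating the unused colour \<open>x\<close> to 0 makes every remainder \<open>(h u * p') mod p\<close> positive,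
    which is what keeps the rounding from losing a unit.\<close>
  have "mod_colouring p' q' G (\<lambda>u. (h u * int p') div int p)"
    unfolding mod_colouring_def
  proof (intro ballI, clarify)
    fix u v assume uv: "(u, v) \<in> parcs G"
    define H where "H w = (h w * int p') div int p" for w
    have verts: "u \<in> pverts G" "v \<in> pverts G" using uv by (auto dest: wellformed')
    have "mod_colouring (int p) (int q) G (\<lambda>u. F u - x)"
      using F by (simp add: mod_colouring_def)
    then have *: "int q \<le> \<bar>h u - h v\<bar>" "\<bar>h u - h v\<bar> \<le> int p - int q"
      using uv q \<open>3 \<le> p\<close> by (auto simp: mod_colouring_iff_reduced h_def)
    have bounds: "0 < int p" "0 < int p'" using pq' \<open>3 \<le> p\<close> by auto
    note diff = floor_scaled_difference[OF pq'_int bounds h h cop']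
    have "int q' \<le> \<bar>H u - H v\<bar> \<and> \<bar>H u - H v\<bar> \<le> int p' - int q'"
    proof (cases "h v \<le> h u")
      case True
      with * diff[OF verts(2,2,1,1)] pq'(2) show ?thesis unfolding H_def by linarith
    next
      case False
      with * diff[OF verts(1,1,2,2)] pq'(2) show ?thesis unfolding H_def by linarith
    qed
    moreover have "0 \<le> H w" "H w < int p'" if "w \<in> pverts G" for w
    proof -
      show "0 \<le> H w" using h[OF that] bounds by (simp add: H_def pos_imp_zdiv_nonneg_iff)
      show "H w < int p'" unfolding H_def
        using h[OF that] bounds by (intro int_less_mult_imp_div_less) simp_all
    qed
    ultimately have "(H u - H v) mod int p' \<in> {int q'..int p' - int q'}"
      using circular_distance_iff_mod[of "int q'" "H u" "int p'" "H v"] pq'(2) verts by simp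
    then show "((h u * int p') div int p - (h v * int p') div int p) mod int p'
        \<in> {int q'..int p' - int q'}"
      by (simp add: H_def)
  qed
  then have "circ_colourable p' q' G" using pq' by (auto simp: circ_colourable_def)
  moreover have "p' * q \<le> p * q'" using pq'(1) by (simp add: mult.commute)
  ultimately show ?thesis using that pq' by blast
qed

text \<open>Strong induction on \<open>p\<close>: a common factor is divided out, and a coprime pair
  descends to its Farey neighbour. The last conjunct is the comparison of ratios, cross-multiplied.
  Only finitely many pairs remain to be compared.\<close>

lemma circ_colourable_bounded:
  assumes G: "pair_graph G" and "circ_colourable p q G"
  shows "\<exists>p' q'. circ_colourable p' q' G \<and> p' \<le> max 2 (card (pverts G)) \<and> p' * q \<le> p * q'"
  using assms(2)
proof (induction p arbitrary: q rule: less_induct)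
  case (less p)
  have q: "0 < q" "2 * q \<le> p" using less.prems by (auto simp: circ_colourable_def)
  show ?case
  proof (cases "p \<le> max 2 (card (pverts G))")
    case True
    then show ?thesis using less.prems by blast
  next
    case False
    have "\<exists>p1 q1. circ_colourable p1 q1 G \<and> p1 < p \<and> p1 * q \<le> p * q1"
    proof (cases "coprime p q")
      case True
      from False have "card (pverts G) < p" "3 \<le> p" by simp_all
      from circ_colourable_descent[OF G less.prems True this] show ?thesis by blast
    next
      case nc: False
      define d where "d = gcd p q"
      obtain p1 q1 where pq1: "p = d * p1" "q = d * q1"
        unfolding d_def by (metis dvdE gcd_dvd1 gcd_dvd2)
      have d: "0 < d" "d \<noteq> 1" using q nc by (auto simp: d_def coprime_iff_gcd_eq_1)
      have "circ_colourable p1 q1 G"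
        using circ_colourable_scale less.prems pq1 d by blast
      moreover have "0 < p1" using pq1 q by (cases p1) auto
      then have "p1 < p" using mult_strict_right_mono[of 1 d p1] pq1 d by simp
      moreover have "p1 * q \<le> p * q1" by (simp add: pq1)
      ultimately show ?thesis by blast
    qed
    then obtain p1 q1 where 1: "circ_colourable p1 q1 G" "p1 < p" "p1 * q \<le> p * q1" by blast
    obtain p' q' where 2: "circ_colourable p' q' G" "p' \<le> max 2 (card (pverts G))"
        "p' * q1 \<le> p1 * q'"
      using less.IH[OF 1(2,1)] by blast
    have "0 < q1" using 1 by (auto simp: circ_colourable_def)
    \<comment> \<open>Transitivity of \<open>p' / q' \<le> p1 / q1 \<le> p / q\<close> in
      cross-multiplied form; the common factor \<open>q1\<close> is cancelled afterwards.\<close>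
    have "q1 * (p' * q) \<le> q * (p1 * q')" using 2 by (simp add: mult.left_commute mult.commute)
    also have "\<dots> \<le> q' * (p * q1)" using 1 by (simp add: mult.left_commute mult.commute)
    finally have "q1 * (p' * q) \<le> q1 * (p * q')" by (simp add: algebra_simps)
    then have "p' * q \<le> p * q'" using \<open>0 < q1\<close> by simp
    with 2 show ?thesis by blast
  qed
qed

text \<open>An injective numbering of the vertices is a colouring with \<open>q = 1\<close>. The
  \<open>max 2\<close> keeps the ratio at least 2 when there are fewer than two vertices.\<close>

lemma ex_circ_colourable:
  assumes G: "pair_graph G"
  shows "circ_colourable (max 2 (card (pverts G))) 1 G"
proof -
  interpret pair_graph G by fact
  obtain f where f: "bij_betw f (pverts G) {0..<card (pverts G)}"
    using ex_bij_betw_finite_nat[OF pair_finite_verts] by blast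
  define N where "N = max 2 (card (pverts G))"
  have lt: "f u < N" if "u \<in> pverts G" for u
    using bij_betwE[OF f] that by (auto simp: N_def)
  have "mod_colouring (int N) (int 1) G (\<lambda>u. int (f u))"
    unfolding mod_colouring_def
  proof (intro ballI, clarify)
    fix u v assume uv: "(u, v) \<in> parcs G"
    then have verts: "u \<in> pverts G" "v \<in> pverts G" "u \<noteq> v"
      by (auto dest: wellformed' no_loops')
    then have "f u \<noteq> f v" using f by (auto simp: bij_betw_def inj_on_def)
    then show "(int (f u) - int (f v)) mod int N \<in> {int 1..int N - int 1}"
      using circular_distance_iff_mod[of 1 "int (f u)" "int N" "int (f v)"]
        lt[OF verts(1)] lt[OF verts(2)] by auto
  qed
  then show ?thesis by (auto simp: circ_colourable_def N_def)
qed

text \<open>The ratios with \<open>p \<le> N\<close> form a finite nonempty set, and each remaining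
  ratio is bounded below by one of them. This gives the \<open>LEAST\<close> over the reals its
  intended value.\<close>

lemma circular_chromatic_number_attained:
  assumes G: "pair_graph G"
  obtains p q where "circ_colourable p q G" "circular_chromatic_number G = real p / real q"
    "\<And>p' q'. circ_colourable p' q' G \<Longrightarrow> real p / real q \<le> real p' / real q'"
proof -
  define N where "N = max 2 (card (pverts G))"
  define X where "X = (\<lambda>(p, q). real p / real q) ` {(p, q). circ_colourable p q G \<and> p \<le> N}"
  have "{(p, q). circ_colourable p q G \<and> p \<le> N} \<subseteq> {..N} \<times> {..N}"
    by (auto simp: circ_colourable_def)
  from finite_subset[OF this] have fin: "finite X" unfolding X_def by simp
  have "X \<noteq> {}" using ex_circ_colourable[OF G] by (auto simp: X_def N_def)
  then have "Min X \<in> X" using fin by simp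
  then obtain p q where pq: "circ_colourable p q G" "Min X = real p / real q"
    by (auto simp: X_def)
  have le: "real p / real q \<le> real p' / real q'" if col: "circ_colourable p' q' G" for p' q'
  proof -
    obtain p1 q1 where 1: "circ_colourable p1 q1 G" "p1 \<le> N" "p1 * q' \<le> p' * q1"
      using circ_colourable_bounded[OF G col] unfolding N_def by blast
    have "real p / real q \<le> real p1 / real q1"
      unfolding pq(2)[symmetric] using fin 1 by (intro Min_le) (auto simp: X_def)
    also have "real p1 / real q1 \<le> real p' / real q'"
    proof -
      have "real p1 * real q' \<le> real p' * real q1"
        using 1(3) by (metis of_nat_le_iff of_nat_mult)
      moreover have "0 < q1" "0 < q'" using 1 col by (auto simp: circ_colourable_def)
      ultimately show ?thesis by (simp add: divide_simps mult.commute)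
    qed
    finally show ?thesis .
  qed
  have "circular_chromatic_number G = real p / real q"
    unfolding circular_chromatic_number_conv[OF G]
    by (rule Least_equality) (use pq le in blast)+
  with pq le show ?thesis using that by blast
qed

lemma circular_chromatic_number_le:
  assumes "pair_graph G" "circ_colourable p q G"
  shows "circular_chromatic_number G \<le> real p / real q"
  using circular_chromatic_number_attained[OF assms(1)] assms(2) by metis

section \<open>Circular colourings pulled back along homomorphisms, and those of cycles\<close>

lemma circ_colourable_hom:
  assumes "graph_hom G H f" "circ_colourable p q H"
  shows "circ_colourable p q G"
proof -
  obtain F where "mod_colouring p q H F" using assms(2) by (auto simp: circ_colourable_def)
  then have "mod_colouring p q G (F \<circ> f)"
    using assms(1) by (fastforce simp: mod_colouring_def graph_hom_def)
  then show ?thesis using assms(2) by (auto simp: circ_colourable_def)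
qed

lemma graph_hom_comp:
  "graph_hom G H f \<Longrightarrow> graph_hom H K g \<Longrightarrow> graph_hom G K (g \<circ> f)"
  by (fastforce simp: graph_hom_def)

lemma bipartite_circ_colourable:
  fixes h :: "'a \<Rightarrow> nat"
  assumes "\<And>u v. (u, v) \<in> parcs G \<Longrightarrow> even (h u) \<noteq> even (h v)"
  shows "circ_colourable 2 1 G"
proof -
  have "(int (h u) - int (h v)) mod 2 = 1" if "(u, v) \<in> parcs G" for u v
    using assms[OF that] by presburger
  then have "mod_colouring 2 1 G (\<lambda>u. int (h u))" by (auto simp: mod_colouring_def)
  then show ?thesis by (auto simp: circ_colourable_def)
qed

lemma even_cycle_graph_circ_colourable:
  assumes "even m"
  shows "circ_colourable 2 1 (cycle_graph m)"
proof (rule bipartite_circ_colourable)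
  fix i j assume "(i, j) \<in> parcs (cycle_graph m)"
  then show "even i \<noteq> even j"
    using assms by (auto simp: cycle_graph_def dvd_mod_iff)
qed

text \<open>Vertex \<open>i\<close> gets colour \<open>k * i\<close>: modulo
  \<open>2 * k + 1\<close>, also across the wrap-around, a step forward changes it by
  \<open>k\<close> and a step back by \<open>- k\<close>, which is \<open>k + 1\<close>.\<close>

lemma odd_cycle_graph_circ_colourable:
  assumes "1 \<le> k"
  shows "circ_colourable (2 * k + 1) k (cycle_graph (2 * k + 1))"
proof -
  define n where "n = 2 * int k + 1"
  have n: "int k mod n = int k" "(- int k) mod n = int k + 1"
    using assms by (simp_all add: n_def zmod_zminus1_eq_if)
  have succ: "(int k * int j - int k * int i) mod n = int k \<and>
      (int k * int i - int k * int j) mod n = int k + 1" if "j = Suc i mod (2 * k + 1)" for i j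
  proof -
    have "int j = (int i + 1) mod n"
      unfolding that n_def by (simp add: zmod_int add.commute)
    then have "int j = int i + 1 + n * (- ((int i + 1) div n))"
      using minus_mult_div_eq_mod[of "int i + 1" n] by simp
    then obtain c where c: "int j = int i + 1 + n * c" by blast
    have "(int k * int j - int k * int i) = int k + n * (int k * c)"
      "(int k * int i - int k * int j) = - int k + n * (- (int k * c))"
      unfolding c by (simp_all add: algebra_simps)
    then show ?thesis using n by (simp only: mod_mult_self2 simp_thms)
  qed
  have "mod_colouring (int (2 * k + 1)) (int k) (cycle_graph (2 * k + 1)) (\<lambda>i. int k * int i)"
    unfolding mod_colouring_def
  proof (intro ballI, clarify)
    fix i j assume "(i, j) \<in> parcs (cycle_graph (2 * k + 1))"
    then have "j = Suc i mod (2 * k + 1) \<or> i = Suc j mod (2 * k + 1)" by (simp add: cycle_graph_def)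
    then have "(int k * int i - int k * int j) mod n \<in> {int k..int k + 1}"
      using succ[of j i] succ[of i j] by (elim disjE) simp_all
    moreover have "int (2 * k + 1) = n" "n - int k = int k + 1" by (simp_all add: n_def)
    ultimately show "(int k * int i - int k * int j) mod int (2 * k + 1)
        \<in> {int k..int (2 * k + 1) - int k}"
      by (simp only:)
  qed
  then show ?thesis using assms unfolding circ_colourable_def by auto
qed

section \<open>From the circular chromatic number to a homomorphism into the odd cycle\<close>

lemma circ_colourable_imp_colourable_odd_cycle:
  assumes G: "pair_graph G" and "circ_colourable (2 * k + 1) k G"
  shows "colourable (cycle_graph (2 * k + 1)) G"
proof -
  interpret pair_graph G by fact
  obtain F where F: "mod_colouring (int (2 * k + 1)) (int k) G F"
    using assms(2) by (auto simp: circ_colourable_def)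
  define n where "n = 2 * int k + 1"
  \<comment> \<open>Modulo \<open>2k + 1\<close>, multiplication by 2 turns the differences \<open>k\<close>, \<open>k + 1\<close> into \<open>-1\<close>, \<open>1\<close>.\<close>
  define f where "f u = nat ((2 * F u) mod n)" for u
  have n: "0 < n" by (simp add: n_def)
  have int_f: "int (f u) = (2 * F u) mod n" for u using n by (simp add: f_def)
  have succ: "f v = Suc (f u) mod (2 * k + 1)" if "(F u - F v) mod n = int k" for u v
  proof -
    have "F u - F v = n * ((F u - F v) div n) + int k"
      using mult_div_mod_eq[of n "F u - F v"] that by simp
    then have "2 * F v = 2 * F u + 1 + n * (- 2 * ((F u - F v) div n) - 1)"
      unfolding n_def by (simp add: algebra_simps)
    then have "int (f v) = (2 * F u + 1) mod n" unfolding int_f by (simp only: mod_mult_self2)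
    also have "\<dots> = (int (f u) + 1) mod n" unfolding int_f by (simp add: mod_add_left_eq)
    also have "\<dots> = int (Suc (f u) mod (2 * k + 1))" by (simp add: n_def zmod_int add.commute)
    finally show ?thesis by simp
  qed
  have "graph_hom G (cycle_graph (2 * k + 1)) f"
    unfolding graph_hom_def
  proof (intro conjI ballI)
    have lt: "f u < 2 * k + 1" for u
    proof -
      have "int (f u) < n" using int_f n by simp
      then show ?thesis by (simp add: n_def)
    qed
    then show "f ` pverts G \<subseteq> pverts (cycle_graph (2 * k + 1))" by (auto simp: cycle_graph_def)
    fix e assume e: "e \<in> parcs G"
    obtain u v where uv: "e = (u, v)" by (cases e)
    have "int (2 * k + 1) = n" "n - int k = int k + 1" by (simp_all add: n_def)
    note F' = F[unfolded mod_colouring_def this]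
    have "(F u - F v) mod n \<in> {int k..int k + 1}" "(F v - F u) mod n \<in> {int k..int k + 1}"
      using F' e arcs_symmetric[of u v] by (auto simp: uv)
    \<comment> \<open>The two differences sum to 0, whereas \<open>2 * (k + 1)\<close> is 1 modulo
      \<open>n\<close>. Hence one of them is \<open>k\<close>, and \<open>succ\<close> applies in
      one direction.\<close>
    moreover have "(F u - F v) mod n \<noteq> int k + 1 \<or> (F v - F u) mod n \<noteq> int k + 1"
    proof (rule ccontr)
      assume "\<not> ?thesis"
      then have "((F u - F v) + (F v - F u)) mod n = (int k + 1 + (int k + 1)) mod n"
        by (metis mod_add_eq)
      also have "int k + 1 + (int k + 1) = 1 + n * 1" by (simp add: n_def)
      finally have "1 mod n = 0" by (simp only: mod_mult_self2) simp
      moreover have "1 < n" using assms(2) by (simp add: n_def circ_colourable_def)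
      ultimately show False by simp
    qed
    ultimately have "(F u - F v) mod n = int k \<or> (F v - F u) mod n = int k" by auto
    then show "case e of (u, v) \<Rightarrow> (f u, f v) \<in> parcs (cycle_graph (2 * k + 1))"
      using succ[of u v] succ[of v u] lt by (auto simp: uv cycle_graph_def)
  qed
  then show ?thesis by (auto simp: colourable_def)
qed

text \<open>The attaining pair need not be in lowest terms, but \<open>k\<close> and
  \<open>2 * k + 1\<close> are coprime, so it is a common multiple \<open>d\<close> of them and
  \<open>circ_colourable_scale\<close> removes \<open>d\<close>.\<close>

lemma colourable_odd_cycle_if_circular_chromatic_number:
  assumes G: "pair_graph G" and "1 \<le> k" "circular_chromatic_number G = real (2 * k + 1) / real k"
  shows "colourable (cycle_graph (2 * k + 1)) G"
proof -
  obtain p q where pq: "circ_colourable p q G" "circular_chromatic_number G = real p / real q"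
    using circular_chromatic_number_attained[OF G] by metis
  have q: "0 < q" using pq by (auto simp: circ_colourable_def)
  have "real p * real k = real (2 * k + 1) * real q"
    using pq(2) assms q by (simp add: frac_eq_eq)
  then have e: "p * k = (2 * k + 1) * q" by (metis of_nat_eq_iff of_nat_mult)
  have "coprime k (2 * k + 1)"
    by (rule coprimeI) (metis dvd_add_right_iff dvd_mult)
  moreover have "k dvd (2 * k + 1) * q" by (metis e dvd_triv_right)
  ultimately have "k dvd q" by (metis coprime_dvd_mult_right_iff)
  then obtain d where d: "q = d * k" by (metis dvdE mult.commute)
  have "k * p = k * (d * (2 * k + 1))" using e by (simp only: d ac_simps)
  then have "p = d * (2 * k + 1)" using assms(2) by (simp only: mult_cancel1) simp
  then have "circ_colourable (2 * k + 1) k G"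
    using circ_colourable_scale pq(1) d q by (metis gr0I mult_0)
  then show ?thesis by (rule circ_colourable_imp_colourable_odd_cycle[OF G])
qed

section \<open>Ranks and simple cycles of relations\<close>

text \<open>The rank counts ancestors. With unique predecessors, the ancestors of \<open>v\<close>
  are \<open>u\<close> and the ancestors of \<open>u\<close>, and acyclicity makes \<open>u\<close>
  a new one. The parity of the rank later serves as a 2-colouring.\<close>

lemma ex_rank_of_acyclic_partial_injection:
  assumes "finite S" "acyclic S" and inj: "\<And>u u' v. (u, v) \<in> S \<Longrightarrow> (u', v) \<in> S \<Longrightarrow> u = u'"
  shows "\<exists>h :: 'a \<Rightarrow> nat. \<forall>(u, v) \<in> S. h v = Suc (h u)"
proof -
  define h where "h v = card {u. (u, v) \<in> S\<^sup>+}" for v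
  have "h v = Suc (h u)" if uv: "(u, v) \<in> S" for u v
  proof -
    have "{x. (x, v) \<in> S\<^sup>+} = insert u {x. (x, u) \<in> S\<^sup>+}"
    proof (intro equalityI subsetI)
      fix x assume "x \<in> {x. (x, v) \<in> S\<^sup>+}"
      then obtain y where "(x, y) \<in> S\<^sup>*" "(y, v) \<in> S" by (auto dest: tranclD2)
      then have "(x, u) \<in> S\<^sup>*" using inj[OF uv] by metis
      then show "x \<in> insert u {x. (x, u) \<in> S\<^sup>+}" by (auto dest: rtranclD)
    qed (use uv in \<open>auto intro: trancl_into_trancl\<close>)
    moreover have "finite {x. (x, u) \<in> S\<^sup>+}"
      by (rule finite_subset[of _ "fst ` S\<^sup>+"]) (use \<open>finite S\<close> in force)+
    moreover have "u \<notin> {x. (x, u) \<in> S\<^sup>+}" using \<open>acyclic S\<close> by (auto simp: acyclic_def)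
    ultimately show ?thesis by (simp add: h_def)
  qed
  then show ?thesis by blast
qed

text \<open>A shortest closed walk through \<open>v\<close> works: the part between two visits to
  the same vertex could be cut out.\<close>

lemma ex_simple_cycle:
  assumes "(v, v) \<in> S\<^sup>+"
  obtains m w where "0 < m" "w 0 = v" "inj_on w {0..<m}"
    "\<And>i. i < m \<Longrightarrow> (w i, w (Suc i mod m)) \<in> S"
proof -
  define P where "P m \<longleftrightarrow> 0 < m \<and> (v, v) \<in> S ^^ m" for m
  define m where "m = (LEAST m. P m)"
  have "\<exists>m. P m" using assms by (auto simp: P_def trancl_power)
  then have "P m" unfolding m_def by (rule LeastI_ex)
  then have "0 < m" "(v, v) \<in> S ^^ m" by (auto simp: P_def)
  then obtain w where w: "w 0 = v" "w m = v" "\<And>i. i < m \<Longrightarrow> (w i, w (Suc i)) \<in> S"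
    by (auto simp: relpow_fun_conv)
  have "w i \<noteq> w j" if "i < j" "j < m" for i j
  proof
    assume eq: "w i = w j"
    have "(v, w i) \<in> S ^^ i"
      unfolding relpow_fun_conv using w that by (intro exI[of _ w]) auto
    moreover have "(w j, v) \<in> S ^^ (m - j)"
      unfolding relpow_fun_conv using w that by (intro exI[of _ "\<lambda>l. w (j + l)"]) auto
    ultimately have "(v, v) \<in> S ^^ (i + (m - j))" unfolding relpow_add using eq by auto
    then have "P (i + (m - j))" using that by (simp add: P_def)
    then have "m \<le> i + (m - j)" unfolding m_def by (rule Least_le)
    then show False using that by simp
  qed
  then have "inj_on w {0..<m}" by (auto simp: inj_on_def) (metis nat_neq_iff)
  moreover have "(w i, w (Suc i mod m)) \<in> S" if "i < m" for i
  proof -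
    have "w (Suc i mod m) = w (Suc i)" using w(1,2) that by (cases "Suc i = m") auto
    then show ?thesis using w(3)[OF that] by simp
  qed
  ultimately show ?thesis using that \<open>0 < m\<close> w(1) by blast
qed

section \<open>Connectedness and isomorphism of pair graphs\<close>

lemma connected_imp_rtrancl:
  assumes "pair_graph G" "Digraph_Component.connected (with_proj G)" "u \<in> pverts G" "v \<in> pverts G"
  shows "(u, v) \<in> (parcs G)\<^sup>*"
proof -
  interpret pair_graph G by fact
  have "strongly_connected (with_proj G)"
    using symmetric_connected_imp_strongly_connected[OF pair_sym_arcs assms(2)] .
  then have "u \<rightarrow>\<^sup>*\<^bsub>with_proj G\<^esub> v" using assms(3,4) by (auto simp: strongly_connected_def)
  then show ?thesis using reachable_rtranclI by fastforce
qed

lemma digraph_iso_graph_image: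
  assumes G: "pair_graph G" and inj: "inj_on f (pverts G)"
    and "graph_image f G = H"
  shows "digraph_iso (with_proj G) (with_proj H)"
proof -
  interpret pair_graph G by fact
  define F where "F = \<lparr>iso_verts = f, iso_arcs = map_prod f f, iso_head = snd, iso_tail = fst\<rparr>"
  have "inj_on (map_prod f f) (parcs G)"
    by (rule inj_on_subset[OF map_prod_inj_on[OF inj inj]]) (auto dest: wellformed')
  then have "digraph_isomorphism F"
    using inj wf_digraph by (auto simp: F_def digraph_isomorphism_def)
  moreover have "with_proj H = app_iso F (with_proj G)"
    using assms(3) by (auto simp: F_def app_iso_def with_proj_def graph_image_def)
  ultimately show ?thesis unfolding digraph_iso_def by blast
qed

lemma digraph_iso_imp_hom:
  assumes "digraph_iso (with_proj G) (with_proj H)"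
  shows "\<exists>f. graph_hom G H f"
proof -
  obtain F where F: "pre_digraph.digraph_isomorphism (with_proj G) F"
      and H: "with_proj H = app_iso F (with_proj G)"
    using assms by (auto simp: digraph_iso_def)
  have eqs: "pverts H = iso_verts F ` pverts G" "parcs H = iso_arcs F ` parcs G"
      "iso_tail F = fst" "iso_head F = snd"
    using arg_cong[OF H, of verts] arg_cong[OF H, of arcs] arg_cong[OF H, of tail]
      arg_cong[OF H, of head] by simp_all
  \<comment> \<open>Since the head and tail maps of the target are the projections, the arc map is
    determined by the vertex map.\<close>
  have "(iso_verts F u, iso_verts F v) = iso_arcs F (u, v)" if "(u, v) \<in> parcs G" for u v
    using F that eqs by (force simp: pre_digraph.digraph_isomorphism_def prod_eq_iff)
  then have "graph_hom G H (iso_verts F)" by (auto simp: graph_hom_def eqs)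
  then show ?thesis by blast
qed

section \<open>Locally injective homomorphisms into an odd cycle\<close>

text \<open>By \<open>loc\<close>, every vertex has at most one \<open>S\<close>-successor and one
  \<open>S\<close>-predecessor, so an \<open>S\<close>-cycle has no edges leaving it and by
  \<open>conn\<close> is all of \<open>G\<close>. The bound \<open>tight\<close> is used twice: to
  obtain such a cycle and to fix its length.\<close>

lemma locally_injective_imp_iso_odd_cycle:
  assumes G: "pair_graph G" and ne: "pverts G \<noteq> {}"
    and conn: "\<And>u v. u \<in> pverts G \<Longrightarrow> v \<in> pverts G \<Longrightarrow> (u, v) \<in> (parcs G)\<^sup>*"
    and k: "1 \<le> k"
    and hom: "graph_hom G (cycle_graph (2 * k + 1)) f"
    and loc: "\<And>x y z. (x, z) \<in> parcs G \<Longrightarrow> (z, y) \<in> parcs G \<Longrightarrow> f x = f y \<Longrightarrow> x = y"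
    and tight: "\<And>p q. circ_colourable p q G \<Longrightarrow> real (2 * k + 1) / real k \<le> real p / real q"
  shows "digraph_iso (with_proj G) (with_proj (cycle_graph (2 * k + 1)))"
proof -
  interpret pair_graph G by fact
  define n where "n = 2 * k + 1"
  define S where "S = {(u, v) \<in> parcs G. f v = Suc (f u) mod n}"
  have lt: "f u < n" if "u \<in> pverts G" for u
    using hom that by (auto simp: graph_hom_def cycle_graph_def n_def)
  have arcs: "(u, v) \<in> S \<or> (v, u) \<in> S" if "(u, v) \<in> parcs G" for u v
    using hom that arcs_symmetric[OF that] by (auto simp: graph_hom_def cycle_graph_def n_def S_def)
  have S_arcs: "S \<subseteq> parcs G" by (auto simp: S_def)
  have fun_S: "v = v'" if "(u, v) \<in> S" "(u, v') \<in> S" for u v v'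
    using that loc[of v u v'] arcs_symmetric by (auto simp: S_def)
  have mod_inj: "a = b" if "Suc a mod n = Suc b mod n" "a < n" "b < n" for a b
    using that by (auto simp: mod_Suc split: if_splits)
  have inj_S: "u = u'" if "(u, v) \<in> S" "(u', v) \<in> S" for u u' v
  proof (rule loc)
    show "(u, v) \<in> parcs G" "(v, u') \<in> parcs G"
      using that arcs_symmetric by (auto simp: S_def)
    then have verts: "u \<in> pverts G" "u' \<in> pverts G" by (auto dest: wellformed')
    have "f v = Suc (f u) mod n" "f v = Suc (f u') mod n" using that by (auto simp: S_def)
    then have "Suc (f u) mod n = Suc (f u') mod n" by simp
    then show "f u = f u'" by (rule mod_inj[OF _ lt[OF verts(1)] lt[OF verts(2)]])
  qed
  have not_bip: "\<not> circ_colourable 2 1 G"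
  proof
    assume "circ_colourable 2 1 G"
    from tight[OF this] show False using k by (simp add: divide_le_eq)
  qed
  have "\<not> acyclic S"
  proof
    assume "acyclic S"
    moreover have "finite S" using finite_subset[OF S_arcs pair_finite_arcs] .
    ultimately obtain h :: "'a \<Rightarrow> nat" where h: "\<And>u v. (u, v) \<in> S \<Longrightarrow> h v = Suc (h u)"
      using ex_rank_of_acyclic_partial_injection[of S] inj_S by blast
    have "circ_colourable 2 1 G"
      by (rule bipartite_circ_colourable[of _ h]) (use arcs h in fastforce)
    then show False using not_bip by simp
  qed
  then obtain v where "(v, v) \<in> S\<^sup>+" by (auto simp: acyclic_def)
  then obtain m w where m: "0 < m" and w0: "w 0 = v" and inj_w: "inj_on w {0..<m}"
    and w: "\<And>i. i < m \<Longrightarrow> (w i, w (Suc i mod m)) \<in> S"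
    by (rule ex_simple_cycle) (rule that)
  have w_vert: "w i \<in> pverts G" if "i < m" for i
    using w[OF that] S_arcs by (auto dest: wellformed')
  have step: "\<exists>j < m. y = w j" if "i < m" "(w i, y) \<in> parcs G" for i y
    using arcs[OF that(2)]
  proof
    assume "(w i, y) \<in> S"
    then show ?thesis using fun_S w[OF that(1)] m by (metis mod_less_divisor)
  next
    assume y: "(y, w i) \<in> S"
    \<comment> \<open>The cyclic predecessor of \<open>i\<close>; adding \<open>m\<close> first
      avoids truncated subtraction at \<open>i = 0\<close>.\<close>
    define j where "j = (i + m - 1) mod m"
    have j: "j < m" "Suc j mod m = i"
      using that m by (auto simp: j_def mod_Suc_eq)
    then show ?thesis using inj_S[OF y] w[OF j(1)] by auto
  qed
  have verts: "pverts G = w ` {0..<m}"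
  proof (intro equalityI subsetI)
    fix u assume "u \<in> pverts G"
    then have "(w 0, u) \<in> (parcs G)\<^sup>*" using conn w_vert m by blast
    then have "\<exists>j < m. u = w j" by induction (use m step in blast)+
    then show "u \<in> w ` {0..<m}" by auto
  qed (use w_vert in auto)
  have fw: "f (w i) = (f v + i) mod n" if "i < m" for i
    using that
  proof (induction i)
    case 0
    then show ?case using lt[OF w_vert] w0 by auto
  next
    case (Suc i)
    then show ?case using w[of i] by (auto simp: S_def mod_Suc_eq)
  qed
  \<comment> \<open>Going once around the cycle adds \<open>m\<close> to the colour and returns to
    \<open>f v\<close>.\<close>
  have "n dvd m"
  proof -
    have "f v = Suc (f (w (m - 1))) mod n" using w[of "m - 1"] m w0 by (simp add: S_def)
    also have "\<dots> = (f v + m) mod n" using fw[of "m - 1"] m by (simp add: mod_Suc_eq)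
    finally have "(f v + m) mod n = (f v + 0) mod n" using lt[OF w_vert[OF m]] w0 by simp
    then show ?thesis
      by (metis add_diff_cancel_left' le_add1 mod_eq_dvd_iff_nat add_0_right)
  qed
  \<comment> \<open>The position on the cycle. As a homomorphism to \<open>cycle_graph m\<close> it
    pulls circular colourings of that cycle back to \<open>G\<close>, where \<open>tight\<close>
    applies.\<close>
  define h where "h = the_inv_into {0..<m} w"
  have h: "h (w i) = i" if "i < m" for i
    unfolding h_def using inj_w that by (simp add: the_inv_into_f_f)
  have hS: "h y = Suc (h x) mod m \<and> h x < m \<and> h y < m" if "(x, y) \<in> S" for x y
  proof -
    have "x \<in> pverts G" using that S_arcs by (auto dest: wellformed')
    then obtain i where i: "i < m" "x = w i" by (auto simp: verts)
    then have "y = w (Suc i mod m)" using w that fun_S by blast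
    then show ?thesis using i h m by simp
  qed
  have hom_m: "graph_hom G (cycle_graph m) h"
    using hS arcs h by (fastforce simp: graph_hom_def cycle_graph_def verts)
  have "odd m" using circ_colourable_hom[OF hom_m] even_cycle_graph_circ_colourable not_bip by blast
  then obtain j where j: "m = 2 * j + 1" by (metis oddE)
  have "k \<le> j" using dvd_imp_le[OF \<open>n dvd m\<close> m] by (simp add: n_def j)
  then have "circ_colourable (2 * j + 1) j G"
    using circ_colourable_hom[OF hom_m] odd_cycle_graph_circ_colourable[of j] k j by simp
  \<comment> \<open>The ratios are \<open>2 + 1 / j\<close> and \<open>2 + 1 / k\<close>, so a
    longer odd cycle would fall below the bound.\<close>
  from tight[OF this] have "j \<le> k"
    using k \<open>k \<le> j\<close> by (simp add: divide_simps algebra_simps)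
  then have mn: "m = n" using \<open>k \<le> j\<close> by (simp add: n_def j)
  \<comment> \<open>With \<open>m = n\<close>, the colours \<open>f v + a\<close> for
    \<open>a < n\<close> are pairwise distinct modulo \<open>n\<close>.\<close>
  have inj_f: "inj_on f (pverts G)"
    unfolding verts
  proof (rule inj_onI)
    have *: "a = b" if "a \<le> b" "b < n" "(f v + a) mod n = (f v + b) mod n" for a b
    proof -
      have "n dvd b - a" using that
        by (metis add_diff_cancel_left add_le_cancel_left mod_eq_dvd_iff_nat)
      then show ?thesis using that nat_dvd_not_less[of "b - a" n] by linarith
    qed
    fix x y assume "x \<in> w ` {0..<m}" "y \<in> w ` {0..<m}" and eq: "f x = f y"
    then obtain a b where ab: "x = w a" "y = w b" "a < m" "b < m" by auto
    then have "(f v + a) mod n = (f v + b) mod n" using eq fw by metis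
    then have "a = b" using *[of a b] *[of b a] ab mn by (metis linear)
    then show "x = y" using ab by simp
  qed
  have "card (pverts G) = n" using inj_w by (simp add: verts card_image mn)
  then have surj_f: "f ` pverts G = {0..<n}"
    using lt inj_f by (intro card_subset_eq) (auto simp: card_image)
  have succ: "(i, Suc i mod n) \<in> map_prod f f ` parcs G \<and> (Suc i mod n, i) \<in> map_prod f f ` parcs G"
    if "i < n" for i
  proof -
    have "i \<in> f ` pverts G" using surj_f that by simp
    then obtain a where a: "a < m" "i = f (w a)" by (auto simp: verts)
    have "(w a, w (Suc a mod m)) \<in> parcs G" "f (w (Suc a mod m)) = Suc i mod n"
      using w[OF a(1)] a(2) by (auto simp: S_def)
    then show ?thesis using arcs_symmetric a(2) by (metis map_prod_imageI)
  qed
  have "map_prod f f ` parcs G = parcs (cycle_graph n)"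
  proof (intro equalityI subsetI)
    show "e \<in> parcs (cycle_graph n)" if "e \<in> map_prod f f ` parcs G" for e
      using hom that by (auto simp: graph_hom_def n_def)
    show "e \<in> map_prod f f ` parcs G" if "e \<in> parcs (cycle_graph n)" for e
      using that succ by (auto simp: cycle_graph_def)
  qed
  then have "graph_image f G = cycle_graph n"
    using surj_f by (simp add: graph_image_def cycle_graph_def)
  then show ?thesis using digraph_iso_graph_image[OF G inj_f] by (simp add: n_def)
qed

section \<open>Maximal folding, and the two implications\<close>

lemma fold_composition_pair_graph:
  assumes "fold_composition G g G'" "pair_graph G"
  shows "pair_graph G'"
  using assms by induction (auto intro: elementary_fold_pair_graph)

lemma rtrancl_graph_image:
  assumes "(u, v) \<in> (parcs G)\<^sup>*"
  shows "(f u, f v) \<in> (parcs (graph_image f G))\<^sup>*"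
  using assms
  by induction (auto simp: graph_image_def intro: rtrancl_into_rtrancl map_prod_imageI)

text \<open>Among the folded graphs that still map to \<open>C\<close>, one with fewest vertices is
  taken. Vertices of equal colour are nonadjacent because \<open>C\<close> has no loops, so two
  distinct ones with a common neighbour are at distance 2 and could be folded further.\<close>

lemma ex_maximal_fold_over_hom:
  assumes G: "pair_graph G" and "graph_hom G C f"
    and loopless: "\<And>c. (c, c) \<notin> parcs C"
  obtains g G' f' where "fold_composition G g G'" "graph_hom G' C f'"
    "\<And>x y z. (x, z) \<in> parcs G' \<Longrightarrow> (z, y) \<in> parcs G' \<Longrightarrow> f' x = f' y \<Longrightarrow> x = y"
proof -
  define P where "P G' \<longleftrightarrow> (\<exists>g f'. fold_composition G g G' \<and> graph_hom G' C f')" for G'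
  have "P G" using assms(2) by (auto simp: P_def intro: fold_composition.refl)
  then obtain G' where G': "P G'" and min: "\<And>K. P K \<Longrightarrow> card (pverts G') \<le> card (pverts K)"
    using ex_has_least_nat[of P G "\<lambda>K. card (pverts K)"] by blast
  obtain g f' where g: "fold_composition G g G'" and f': "graph_hom G' C f'"
    using G' by (auto simp: P_def)
  have pg: "pair_graph G'" using fold_composition_pair_graph[OF g G] .
  interpret G': pair_graph G' by (fact pg)
  have "x = y" if xz: "(x, z) \<in> parcs G'" and zy: "(z, y) \<in> parcs G'" and eq: "f' x = f' y" for x y z
  proof (rule ccontr)
    assume "x \<noteq> y"
    have "(x, y) \<notin> parcs G'" using f' loopless[of "f' x"] eq by (auto simp: graph_hom_def)
    then have d: "graph_distance G' x y = 2"
      using graph_distance_eq_2_iff[OF pg] xz zy \<open>x \<noteq> y\<close> by blast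
    have verts: "x \<in> pverts G'" "y \<in> pverts G'" using xz zy by (auto dest: G'.wellformed')
    \<comment> \<open>The merged vertex keeps the name \<open>x\<close>, so \<open>f'\<close> itself
      is still a homomorphism on \<open>K\<close>, and only \<open>y\<close> disappears.\<close>
    define K where "K = graph_image (identify x y x) G'"
    have "elementary_fold G' (identify x y x) K"
      unfolding elementary_fold_def K_def using verts d by blast
    then have "fold_composition G (identify x y x \<circ> g) K" by (rule fold_composition.step[OF g])
    moreover have "f' (identify x y x u) = f' u" for u using eq by (simp add: identify_def)
    then have "graph_hom K C f'" using f' by (fastforce simp: K_def graph_image_def graph_hom_def)
    ultimately have "P K" by (auto simp: P_def)
    then have "card (pverts G') \<le> card (pverts K)" by (rule min)
    moreover have "pverts K \<subseteq> pverts G' - {y}"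
      using verts \<open>x \<noteq> y\<close> by (auto simp: K_def graph_image_def identify_def)
    then have "card (pverts K) < card (pverts G')"
      using verts by (intro psubset_card_mono) auto
    ultimately show False by simp
  qed
  then show ?thesis using that g f' by blast
qed

theorem corollary4p10:
  fixes k :: nat
  assumes "1 \<le> k"
  shows "(\<forall>G :: 'a pair_pre_digraph.
            pair_graph G \<longrightarrow> Digraph_Component.connected (with_proj G) \<longrightarrow>
            circular_chromatic_number G = real (2 * k + 1) / real k \<longrightarrow>
            folds_to G (cycle_graph (2 * k + 1))) \<and>
         (\<forall>H :: 'b pair_pre_digraph.
            pair_graph H \<longrightarrow> folds_to H (cycle_graph (2 * k + 1)) \<longrightarrow>
            colourable (cycle_graph (2 * k + 1)) H)"
proof (intro conjI allI impI)
  fix G :: "'a pair_pre_digraph"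
  assume G: "pair_graph G" and conn: "Digraph_Component.connected (with_proj G)"
    and chi: "circular_chromatic_number G = real (2 * k + 1) / real k"
  interpret C: pair_graph "cycle_graph (2 * k + 1)"
    using assms by (intro pair_graph_cycle_graph) simp
  obtain f where f: "graph_hom G (cycle_graph (2 * k + 1)) f"
    using colourable_odd_cycle_if_circular_chromatic_number[OF G assms chi]
    by (auto simp: colourable_def)
  have "(c, c) \<notin> parcs (cycle_graph (2 * k + 1))" for c using C.no_loops' by blast
  with G f obtain g G' f' where g: "fold_composition G g G'"
    and f': "graph_hom G' (cycle_graph (2 * k + 1)) f'"
    and loc: "\<And>x y z. (x, z) \<in> parcs G' \<Longrightarrow> (z, y) \<in> parcs G' \<Longrightarrow> f' x = f' y \<Longrightarrow> x = y"
    by (rule ex_maximal_fold_over_hom) (rule that)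
  have img: "graph_image g G = G'" using fold_composition_image[OF g] .
  have "digraph_iso (with_proj G') (with_proj (cycle_graph (2 * k + 1)))"
  proof (rule locally_injective_imp_iso_odd_cycle[OF _ _ _ assms f' loc])
    show "pair_graph G'" using fold_composition_pair_graph[OF g G] .
    \<comment> \<open>The library's notion of connectedness includes having a vertex.\<close>
    have "pverts G \<noteq> {}" using conn by (auto simp: connected_def strongly_connected_def mk_symmetric_def)
    then show "pverts G' \<noteq> {}" by (auto simp flip: img simp: graph_image_def)
    show "(u, v) \<in> (parcs G')\<^sup>*" if "u \<in> pverts G'" "v \<in> pverts G'" for u v
      using that rtrancl_graph_image[OF connected_imp_rtrancl[OF G conn], of _ _ g]
      by (auto simp flip: img simp: graph_image_def)
    \<comment> \<open>Colourings of the folded graph pull back along \<open>g\<close>, so its ratios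
      obey the lower bound known for \<open>G\<close>.\<close>
    show "real (2 * k + 1) / real k \<le> real p / real q" if "circ_colourable p q G'" for p q
    proof -
      have "circ_colourable p q G"
        using circ_colourable_hom[OF _ that, of G g] graph_hom_graph_image[of G g] img by simp
      then show ?thesis using circular_chromatic_number_le[OF G] chi by metis
    qed
  qed
  then show "folds_to G (cycle_graph (2 * k + 1))" using g img by (auto simp: folds_to_def)
next
  fix H :: "'b pair_pre_digraph"
  assume "folds_to H (cycle_graph (2 * k + 1))"
  then obtain g :: "'b \<Rightarrow> 'b" where
    "digraph_iso (with_proj (graph_image g H)) (with_proj (cycle_graph (2 * k + 1)))"
    unfolding folds_to_def by blast
  \<comment> \<open>The required colouring is \<open>g\<close>, a homomorphism onto its image,
    followed by this \<open>f\<close>.\<close>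
  then obtain f where "graph_hom (graph_image g H) (cycle_graph (2 * k + 1)) f"
    using digraph_iso_imp_hom by blast
  then show "colourable (cycle_graph (2 * k + 1)) H"
    using graph_hom_comp[OF graph_hom_graph_image] unfolding colourable_def by blast
qed

end
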